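(* Let $n$ be a friend of $10$ and let $q_3$, $q_4$ be the third and fourth smallest prime divisors of $n$ respectively. Then $$11\leq q_3 < \left\lceil\frac{427\,\omega(n)}{100}\right\rceil\left\{\log\left(\left\lceil\frac{427\,\omega(n)}{100}\right\rceil\right)+2\log\log\left(\left\lceil\frac{427\,\omega(n)}{100}\right\rceil\right)\right\}$$ and $$13\leq q_4 < \left\lceil\frac{41\,\omega(n)}{5}\right\rceil\left\{\log\left(\left\lceil\frac{41\,\omega(n)}{5}\right\rceil\right)+2\log\log\left(\left\lceil\frac{41\,\omega(n)}{5}\right\rceil\right)\right\}.$$
   Context: For a positive integer $m$, $\sigma(m)$ is the sum of the positive divisors of $m$ and $I(m)=\sigma(m)/m$ is its abundancy index. A friend of $10$ is a positive integer $n \neq 10$ with $I(n)=I(10)=\frac{9}{5}$. $\omega(n)$ denotes the number of distinct prime divisors of $n$, and the $k$-th smallest prime divisor of $n$ is the $k$-th element of the increasing list of its distinct prime divisors (it is known from earlier literature that a friend of $10$ has at least ten distinct prime divisors, so $q_3$ and $q_4$ exist). $\lceil\cdot\rceil$ is the ceiling function and $\log$ is the natural logarithm. *)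

theory Defs
  imports Complex_Main "HOL-Computational_Algebra.Primes"
begin

definition divisor_sum :: "nat \<Rightarrow> nat" where
  "divisor_sum m = (\<Sum>d | d dvd m. d)"

definition abundancy :: "nat \<Rightarrow> real" where
  "abundancy m = real (divisor_sum m) / real m"

definition friend_of_10 :: "nat \<Rightarrow> bool" where
  "friend_of_10 n \<longleftrightarrow> n > 0 \<and> n \<noteq> 10 \<and> abundancy n = abundancy 10"

definition omega :: "nat \<Rightarrow> nat" where
  "omega n = card (prime_factors n)"

(* Counted from k = 1, unlike list indexing; meaningful only for
   1 \<le> k \<le> omega n. *)
definition prime_divisor_nth :: "nat \<Rightarrow> nat \<Rightarrow> nat" where
  "prime_divisor_nth n k = sorted_list_of_set (prime_factors n) ! (k - 1)"

lemma abundancy_10: "abundancy 10 = 9 / 5"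
proof -
  have "{d::nat. d dvd 10} = set (filter (\<lambda>d. d dvd 10) [0..<11])"
    by (auto dest: dvd_imp_le)
  also have "\<dots> = {1, 2, 5, 10}"
    by code_simp
  finally show ?thesis
    by (simp add: abundancy_def divisor_sum_def)
qed

end

theory Submission
  imports Defs
begin

text \<open>
  Write \<open>w\<close> for the number of distinct prime divisors of \<open>n\<close>.  The upper bounds hold because the
  abundancy index of \<open>n\<close> is at most the product of \<open>p / (p - 1)\<close> over the primes \<open>p\<close> dividing \<open>n\<close>,
  and this product is small when the primes are large.  The primes from the \<open>k\<close>-th one on, \<open>q\<close> say,
  are at least \<open>q, q + 1, q + 2, \<dots>\<close>, so their factors contribute at most the telescoping product
  \<open>(q + w - k) / (q - 1)\<close> (\<open>prod_euler_factor_telescope\<close>).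

  A friend \<open>n\<close> of 10 satisfies \<open>5 \<sigma>(n) = 9 n\<close>.  It is divisible by 5, hence odd, because a proper
  multiple of 10 has a larger index than 10.  It is also coprime to 3
  (\<open>friend_of_10_not_dvd_3\<close>): since \<open>\<sigma>(n)\<close> is odd, neither 3 nor 5 divides \<open>n\<close> exactly once, and
  then \<open>n\<close> has a divisor, \<open>27 * 25\<close> or \<open>9 * 25 * 13\<close>, whose index already exceeds \<open>9 / 5\<close>.

  Hence the prime divisors of \<open>n\<close> are, in increasing order, at least 5, 7, 11, 13.  This gives the
  lower bounds.  It also gives \<open>9/5 \<le> (5/4) (7/6) (q\<^sub>3 + w - 3) / (q\<^sub>3 - 1)\<close> and
  \<open>9/5 \<le> (5/4) (7/6) (11/10) (q\<^sub>4 + w - 4) / (q\<^sub>4 - 1)\<close>, that is,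
  \<open>q\<^sub>3 - 1 \<le> (175/41) (w - 2)\<close> and \<open>q\<^sub>4 - 1 \<le> (385/47) (w - 3)\<close>.  The two fractions lie just
  below \<open>427/100\<close> and \<open>41/5\<close>, so \<open>q\<^sub>3 < 427 w / 100\<close> and \<open>q\<^sub>4 < 41 w / 5\<close>.  These bounds are linear
  in \<open>w\<close>, and the logarithmic factors in the claim are at least 1.
\<close>

section \<open>The divisor sum\<close>

lemma divisor_sum_mult_coprime:
  assumes "coprime a b"
  shows "divisor_sum (a * b) = divisor_sum a * divisor_sum b"
proof -
  have split_divisors: "{d. d dvd a * b} = (\<lambda>(x, y). x * y) ` ({d. d dvd a} \<times> {d. d dvd b})"
    using division_decomp[of _ a b] by (fastforce intro: mult_dvd_mono)
  have inj: "inj_on (\<lambda>(x, y). x * y) ({d. d dvd a} \<times> {d. d dvd b})"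
  proof (rule inj_onI, clarsimp)
    fix x y x' y' assume h: "x dvd a" "y dvd b" "x' dvd a" "y' dvd b" "x * y = x' * y'"
    have cop: "coprime x y'" "coprime x' y" "coprime x y" "coprime x' y'"
      using assms h by (meson coprime_divisors)+
    show "x = x' \<and> y = y'"
      using h(5) cop coprime_crossproduct_nat[of x y' x' y] by metis
  qed
  have "divisor_sum (a * b) = (\<Sum>(x, y)\<in>{d. d dvd a} \<times> {d. d dvd b}. x * y)"
    unfolding divisor_sum_def split_divisors using inj
    by (simp add: sum.reindex case_prod_unfold)
  also have "\<dots> = divisor_sum a * divisor_sum b"
    unfolding divisor_sum_def by (simp add: sum_product sum.cartesian_product)
  finally show ?thesis .
qed

lemma divisor_sum_prime_power:
  assumes "prime p"
  shows "divisor_sum (p ^ k) = (\<Sum>i\<le>k. p ^ i)"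
proof -
  have "{d. d dvd p ^ k} = (\<lambda>i. p ^ i) ` {..k}"
    using assms by (auto simp: divides_primepow_nat)
  moreover have "inj_on (\<lambda>i. p ^ i) {..k}"
    using prime_gt_1_nat[OF assms] by (auto intro!: inj_onI)
  ultimately show ?thesis
    by (simp add: divisor_sum_def sum.reindex)
qed

lemma abundancy_mult_coprime:
  "coprime a b \<Longrightarrow> abundancy (a * b) = abundancy a * abundancy b"
  by (simp add: abundancy_def divisor_sum_mult_coprime)

lemma divisor_sum_exact_prime_power_dvd:
  assumes "prime p" "n = p ^ k * m" "\<not> p dvd m"
  shows "divisor_sum (p ^ k) dvd divisor_sum n"
  using assms by (simp add: divisor_sum_mult_coprime prime_imp_coprime)

text \<open>
  Multiplying the divisors of \<open>d\<close> by \<open>m\<close> gives divisors of \<open>m * d\<close>.  If \<open>m \<noteq> 1\<close> then the divisor 1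
  is not among them, hence the extra term, which makes the inequality of the indices strict.
\<close>
lemma divisor_sum_multiple:
  assumes "m > 0" "d > 0"
  shows "m * divisor_sum d + (if m = 1 then 0 else 1) \<le> divisor_sum (m * d)"
proof -
  define A where "A = (*) m ` {x. x dvd d}"
  define B where "B = {1::nat} - {m}"
  have fin: "finite A" "finite B"
    using assms by (simp_all add: A_def B_def)
  have disjoint: "A \<inter> B = {}"
    by (auto simp: A_def B_def)
  have sub: "A \<union> B \<subseteq> {x. x dvd m * d}"
    by (auto simp: A_def B_def)
  have "m * divisor_sum d = \<Sum>A"
    unfolding A_def divisor_sum_def using assms
    by (simp add: sum.reindex inj_on_def sum_distrib_left)
  moreover have "(if m = 1 then 0 else 1) = \<Sum>B"
    unfolding B_def by auto
  moreover have "\<Sum>A + \<Sum>B = \<Sum>(A \<union> B)"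
    using sum.union_disjoint[OF fin disjoint, of "\<lambda>x. x"] by (rule sym)
  moreover have "\<Sum>(A \<union> B) \<le> divisor_sum (m * d)"
    unfolding divisor_sum_def
  proof (rule sum_mono2)
    show "finite {x. x dvd m * d}" using assms by simp
  qed (use sub in auto)
  ultimately show ?thesis by presburger
qed

lemma abundancy_mono:
  assumes "d dvd n" "n > 0"
  shows "abundancy d \<le> abundancy n"
proof -
  obtain m where m: "n = m * d" using assms(1) by (metis dvd_def mult.commute)
  hence pos: "m > 0" "d > 0" using assms(2) by auto
  have "m * divisor_sum d \<le> divisor_sum n"
    using divisor_sum_multiple[OF pos] m by simp
  hence "real m * real (divisor_sum d) \<le> real (divisor_sum n)"
    by (metis of_nat_le_iff of_nat_mult)
  thus ?thesis using pos m by (simp add: abundancy_def field_simps)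
qed

section \<open>The Euler product bound\<close>

text \<open>This is \<open>1 / (1 - 1/p)\<close>, the supremum of the indices of the powers of a prime \<open>p\<close>.\<close>
definition euler_factor :: "nat \<Rightarrow> real" where
  "euler_factor p = real p / (real p - 1)"

lemma euler_factor_antimono: "2 \<le> p \<Longrightarrow> p \<le> q \<Longrightarrow> euler_factor q \<le> euler_factor p"
  by (simp add: euler_factor_def field_simps)

lemma euler_factor_nonneg: "2 \<le> p \<Longrightarrow> 0 \<le> euler_factor p"
  by (simp add: euler_factor_def)

lemma abundancy_prime_power_le:
  assumes "prime p"
  shows "abundancy (p ^ k) \<le> euler_factor p"
proof -
  have p: "real p > 1" using prime_gt_1_nat[OF assms] by simp
  have "real (divisor_sum (p ^ k)) = (\<Sum>i\<le>k. real p ^ i)"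
    using assms by (simp add: divisor_sum_prime_power)
  also have "\<dots> = (real p ^ Suc k - 1) / (real p - 1)"
    using p by (simp add: geometric_sum lessThan_Suc_atMost[symmetric] del: sum.lessThan_Suc)
  also have "\<dots> \<le> real p ^ k * euler_factor p"
    using p by (simp add: euler_factor_def divide_right_mono mult.commute)
  finally show ?thesis
    using p by (simp add: abundancy_def field_simps)
qed

text \<open>
  The index is multiplicative, so the bound for prime powers carries over by splitting off the full
  power of one prime at a time.
\<close>
lemma abundancy_le_prod_euler_factor:
  assumes "n > 0"
  shows "abundancy n \<le> (\<Prod>p\<in>prime_factors n. euler_factor p)"
  using assms
proof (induction n rule: less_induct)
  case (less n)
  show ?case
  proof (cases "n = 1")
    case True
    thus ?thesis by (simp add: abundancy_def divisor_sum_def)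
  next
    case False
    then obtain p where p: "prime p" "p dvd n" using prime_factor_nat by blast
    define k where "k = multiplicity p n"
    obtain m where n: "n = p ^ k * m" and ndvd: "\<not> p dvd m"
    proof (rule multiplicity_decompose'[of n p])
      show "n \<noteq> 0" using less.prems by simp
      show "\<not> is_unit p" using p(1) not_prime_unit by blast
    qed (auto simp: k_def)
    have m: "m > 0" using n less.prems by auto
    have "k > 0" using p n ndvd by (cases k) auto
    have "p ^ k > 1" using \<open>k > 0\<close> prime_gt_1_nat[OF p(1)] one_less_power by blast
    hence "m < n" using n m by simp
    have factors: "prime_factors n = insert p (prime_factors m)"
    proof -
      have "x dvd p ^ k \<longleftrightarrow> x = p" if "prime x" for x
        using that p(1) \<open>k > 0\<close> by (auto simp: prime_dvd_power_iff dest: primes_dvd_imp_eq)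
      thus ?thesis
        unfolding n using m p(1) by (auto simp: prime_factors_dvd prime_dvd_mult_iff)
    qed
    have "abundancy n = abundancy (p ^ k) * abundancy m"
      unfolding n using p(1) ndvd by (intro abundancy_mult_coprime) (simp add: prime_imp_coprime)
    also have "\<dots> \<le> euler_factor p * (\<Prod>p\<in>prime_factors m. euler_factor p)"
      using less.IH[OF \<open>m < n\<close> m] abundancy_prime_power_le[OF p(1), of k] prime_ge_2_nat[OF p(1)]
      by (intro mult_mono) (auto simp: euler_factor_nonneg abundancy_def)
    also have "\<dots> = (\<Prod>p\<in>prime_factors n. euler_factor p)"
    proof -
      have "p \<notin> prime_factors m" using ndvd by auto
      thus ?thesis unfolding factors by simp
    qed
    finally show ?thesis .
  qed
qed

text \<open>
  The entries are at least \<open>y, y + 1, y + 2, \<dots>\<close>, and for these values the product telescopes.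
\<close>
lemma prod_euler_factor_telescope:
  assumes "sorted_wrt (<) (y # ys)" "2 \<le> y"
  shows "prod_list (map euler_factor (y # ys)) \<le> (real y + real (length ys)) / (real y - 1)"
  using assms
proof (induction ys arbitrary: y)
  case Nil
  thus ?case by (simp add: euler_factor_def)
next
  case (Cons z zs)
  let ?l = "real (length zs)"
  have zy: "real z \<ge> real y + 1" and y: "real y \<ge> 2" using Cons.prems by auto
  have "prod_list (map euler_factor (z # zs)) \<le> (real z + ?l) / (real z - 1)"
    using Cons by auto
  also have "\<dots> = 1 + (?l + 1) / (real z - 1)"
    using zy y by (simp add: field_simps)
  also have "\<dots> \<le> 1 + (?l + 1) / real y"
    using zy y by (intro add_left_mono divide_left_mono) auto
  finally have "prod_list (map euler_factor (z # zs)) \<le> 1 + (?l + 1) / real y" .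
  hence "prod_list (map euler_factor (y # z # zs)) \<le> euler_factor y * (1 + (?l + 1) / real y)"
    using Cons.prems by (simp add: mult_left_mono euler_factor_nonneg)
  also have "\<dots> = (real y + real (length (z # zs))) / (real y - 1)"
    using y by (simp add: euler_factor_def field_simps)
  finally show ?case .
qed

section \<open>Prime divisors of a friend of 10\<close>

lemma friend_of_10_divisor_sum:
  assumes "friend_of_10 n"
  shows "5 * divisor_sum n = 9 * n"
proof -
  have "5 * real (divisor_sum n) = 9 * real n"
    using assms unfolding friend_of_10_def abundancy_10 by (auto simp: abundancy_def field_simps)
  thus ?thesis by linarith
qed

lemma friend_of_10_dvd_5:
  assumes "friend_of_10 n"
  shows "5 dvd n"
proof -
  have "5 dvd 9 * n" using friend_of_10_divisor_sum[OF assms] by (metis dvd_triv_left)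
  thus ?thesis by presburger
qed

text \<open>Otherwise \<open>n\<close> is a proper multiple of 10, and its index is strictly larger than that of 10.\<close>
lemma friend_of_10_odd:
  assumes "friend_of_10 n"
  shows "odd n"
proof
  assume "even n"
  hence "10 dvd n" using friend_of_10_dvd_5[OF assms] by presburger
  then obtain m where m: "n = m * 10" by (metis dvd_def mult.commute)
  have "m > 0" "m \<noteq> 1" using assms m by (auto simp: friend_of_10_def)
  hence "m * divisor_sum 10 + 1 \<le> divisor_sum n"
    using divisor_sum_multiple[of m 10] m by simp
  moreover have "divisor_sum 10 = 18"
    using abundancy_10 by (simp add: abundancy_def)
  ultimately show False
    using friend_of_10_divisor_sum[OF assms] m by simp
qed

text \<open>
  The divisor sum of \<open>n\<close> is odd, whereas an exact divisor \<open>p\<close> would contribute the even factor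
  \<open>p + 1\<close> to it.
\<close>
lemma friend_of_10_prime_square_dvd:
  assumes "friend_of_10 n" "prime p" "p dvd n"
  shows "p\<^sup>2 dvd n"
proof (rule ccontr)
  assume not_dvd: "\<not> p\<^sup>2 dvd n"
  obtain m where m: "n = p ^ 1 * m" using assms(3) by (auto elim: dvdE)
  have "\<not> p dvd m" using not_dvd m by (auto simp: power2_eq_square)
  hence "p + 1 dvd divisor_sum n"
    using divisor_sum_exact_prime_power_dvd[OF assms(2) m] divisor_sum_prime_power[OF assms(2), of 1]
    by simp
  moreover have "odd p" using dvd_trans[OF _ assms(3), of 2] friend_of_10_odd[OF assms(1)] by blast
  ultimately have "even (divisor_sum n)" using dvd_trans[of 2 "p + 1"] by simp
  hence "even (9 * n)"
    unfolding friend_of_10_divisor_sum[OF assms(1), symmetric] by simp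
  thus False using friend_of_10_odd[OF assms(1)] by simp
qed

text \<open>
  The index of \<open>9 * 25\<close> falls just short of \<open>9 / 5\<close>, so one further factor is needed.  If 27 does
  not divide \<open>n\<close>, it comes from \<open>\<sigma>(9) = 13\<close>, which must then divide \<open>\<sigma>(n)\<close> and hence \<open>n\<close>.
\<close>
lemma friend_of_10_not_dvd_3:
  assumes "friend_of_10 n"
  shows "\<not> 3 dvd n"
proof
  assume "3 dvd n"
  have n: "n > 0" and index: "abundancy n = 9 / 5"
    using assms by (auto simp: friend_of_10_def abundancy_10)
  have nine: "9 dvd n"
    using friend_of_10_prime_square_dvd[OF assms _ \<open>3 dvd n\<close>] by simp
  have twentyfive: "25 dvd n"
    using friend_of_10_prime_square_dvd[OF assms _ friend_of_10_dvd_5[OF assms]] by simp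
  have sigma: "divisor_sum 9 = 13" "divisor_sum 27 = 40" "divisor_sum 25 = 31" "divisor_sum 13 = 14"
    using divisor_sum_prime_power[of 3 "Suc (Suc 0)"]
      divisor_sum_prime_power[of 3 "Suc (Suc (Suc 0))"]
      divisor_sum_prime_power[of 5 "Suc (Suc 0)"] divisor_sum_prime_power[of 13 "Suc 0"]
    by simp_all
  show False
  proof (cases "27 dvd n")
    case True
    have cop: "coprime 27 (25::nat)" by (simp add: coprime_iff_gcd_eq_1 gcd_non_0_nat)
    have "27 * 25 dvd n" using True twentyfive cop by (rule divides_mult)
    moreover have "abundancy (27 * 25) = 40 / 27 * (31 / 25)"
      using abundancy_mult_coprime[OF cop] sigma by (simp add: abundancy_def)
    ultimately show False using abundancy_mono[of "27 * 25" n] n index by simp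
  next
    case False
    obtain m where m: "n = 3 ^ 2 * m" using nine by auto
    have "\<not> 3 dvd m" using False m by auto
    hence "13 dvd divisor_sum n"
      using divisor_sum_exact_prime_power_dvd[of 3, OF _ m] sigma by simp
    hence "13 dvd 9 * n"
      unfolding friend_of_10_divisor_sum[OF assms, symmetric] by (rule dvd_mult)
    hence thirteen: "13 dvd n" by presburger
    have cop: "coprime 9 (25::nat)" "coprime (9 * 25) (13::nat)"
      by (simp_all add: coprime_iff_gcd_eq_1 gcd_non_0_nat)
    have "9 * 25 * 13 dvd n" using nine twentyfive thirteen cop by (meson divides_mult)
    moreover have "abundancy (9 * 25 * 13) = 13 / 9 * (31 / 25) * (14 / 13)"
      using abundancy_mult_coprime[OF cop(1)] abundancy_mult_coprime[OF cop(2)] sigma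
      by (simp add: abundancy_def)
    ultimately show False using abundancy_mono[of "9 * 25 * 13" n] n index by simp
  qed
qed

lemma friend_of_10_prime_divisor_ge_5:
  assumes "friend_of_10 n" "prime p" "p dvd n"
  shows "5 \<le> p"
proof -
  have "p \<noteq> 2" "p \<noteq> 3"
    using assms friend_of_10_odd friend_of_10_not_dvd_3 by auto
  moreover have "p \<noteq> 4"
    using assms(2) by auto
  moreover note prime_ge_2_nat[OF assms(2)]
  ultimately show ?thesis by linarith
qed

lemma prime_nat_gaps:
  fixes p :: nat
  assumes "prime p"
  shows "5 < p \<Longrightarrow> 7 \<le> p" "7 < p \<Longrightarrow> 11 \<le> p" "11 < p \<Longrightarrow> 13 \<le> p"
proof -
  have "\<not> prime (6::nat)" "\<not> prime (8::nat)" "\<not> prime (9::nat)" "\<not> prime (10::nat)"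
    "\<not> prime (12::nat)"
    by simp_all
  hence "p \<noteq> 6" "p \<noteq> 8" "p \<noteq> 9" "p \<noteq> 10" "p \<noteq> 12" using assms by auto
  thus "5 < p \<Longrightarrow> 7 \<le> p" "7 < p \<Longrightarrow> 11 \<le> p" "11 < p \<Longrightarrow> 13 \<le> p" by auto
qed

text \<open>
  Three primes do not suffice, because \<open>(5/4) (7/6) (11/10) < 9/5\<close>.
\<close>
lemma friend_of_10_prime_divisors:
  assumes "friend_of_10 n"
  obtains a b c d ys where
    "sorted_list_of_set (prime_factors n) = a # b # c # d # ys"
    "5 \<le> a" "7 \<le> b" "11 \<le> c" "13 \<le> d"
    "sorted_wrt (<) (c # d # ys)"
    "9 / 5 \<le> prod_list (map euler_factor (a # b # c # d # ys))"
proof -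
  define xs where "xs = sorted_list_of_set (prime_factors n)"
  have sorted: "sorted_wrt (<) xs" and set: "set xs = prime_factors n" and "distinct xs"
    by (simp_all add: xs_def)
  have "n > 0" and index: "abundancy n = 9 / 5"
    using assms by (auto simp: friend_of_10_def abundancy_10)
  have bound: "9 / 5 \<le> prod_list (map euler_factor xs)"
    using abundancy_le_prod_euler_factor[OF \<open>n > 0\<close>] index \<open>distinct xs\<close>
    by (simp add: set[symmetric] prod.distinct_set_conv_list)
  have ge5: "5 \<le> p" and prime: "prime p" if "p \<in> set xs" for p
    using that friend_of_10_prime_divisor_ge_5[OF assms] by (auto simp: set prime_factors_dvd)
  have factor5: "euler_factor p \<le> 5 / 4" if "5 \<le> p" for p
    using euler_factor_antimono[OF _ that] by (simp add: euler_factor_def)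
  have factor7: "euler_factor p \<le> 7 / 6" if "7 \<le> p" for p
    using euler_factor_antimono[OF _ that] by (simp add: euler_factor_def)
  have factor11: "euler_factor p \<le> 11 / 10" if "11 \<le> p" for p
    using euler_factor_antimono[OF _ that] by (simp add: euler_factor_def)
  obtain a xs1 where xs1: "xs = a # xs1" using bound by (cases xs) auto
  have a: "5 \<le> a" using ge5 xs1 by simp
  obtain b xs2 where xs2: "xs1 = b # xs2"
    using bound factor5[OF a] xs1 by (cases xs1) auto
  have b: "7 \<le> b" using prime_nat_gaps(1)[OF prime, of b] a sorted xs1 xs2 by auto
  have ab: "euler_factor a * euler_factor b \<le> 5 / 4 * (7 / 6)"
    using a b by (intro mult_mono factor5 factor7 euler_factor_nonneg) auto
  obtain c xs3 where xs3: "xs2 = c # xs3"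
    using bound ab xs1 xs2 by (cases xs2) auto
  have c: "11 \<le> c" using prime_nat_gaps(2)[OF prime, of c] b sorted xs1 xs2 xs3 by auto
  have "euler_factor a * euler_factor b * euler_factor c \<le> 5 / 4 * (7 / 6) * (11 / 10)"
    using a b c by (intro mult_mono[OF ab] factor11 euler_factor_nonneg) auto
  then obtain d ys where ys: "xs3 = d # ys"
    using bound xs1 xs2 xs3 by (cases xs3) (auto simp: mult.assoc)
  have d: "13 \<le> d" using prime_nat_gaps(3)[OF prime, of d] c sorted xs1 xs2 xs3 ys by auto
  have "xs = a # b # c # d # ys" using xs1 xs2 xs3 ys by simp
  thus ?thesis using that a b c d sorted bound unfolding xs_def[symmetric] by simp
qed

section \<open>The bounds on the third and fourth prime divisors\<close>

text \<open>
  The ceiling is an integer above 2, hence at least 3 and larger than \<open>e\<close>.  So its logarithm is at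
  least 1, its iterated logarithm is nonnegative, and the right-hand side is at least \<open>y\<close>.
\<close>
lemma less_ceiling_times_log_factor:
  fixes x y :: real
  assumes "x < y" "2 < y"
  shows "x < real_of_int \<lceil>y\<rceil> * (ln (real_of_int \<lceil>y\<rceil>) + 2 * ln (ln (real_of_int \<lceil>y\<rceil>)))"
proof -
  define N where "N = real_of_int \<lceil>y\<rceil>"
  have "y \<le> N" by (simp add: N_def)
  have "3 \<le> \<lceil>y\<rceil>" using assms(2) by linarith
  hence N: "3 \<le> N" by (simp add: N_def)
  hence "exp 1 \<le> N" using exp_le by linarith
  hence "1 \<le> ln N" using N by (subst ln_ge_iff) auto
  moreover from this have "0 \<le> ln (ln N)" by (rule ln_ge_zero)
  ultimately have "1 \<le> ln N + 2 * ln (ln N)" by linarith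
  hence "N * 1 \<le> N * (ln N + 2 * ln (ln N))" using N by (intro mult_left_mono) auto
  thus ?thesis unfolding N_def[symmetric] using assms(1) \<open>y \<le> N\<close> by linarith
qed

theorem corollary1p1:
  fixes n q3 q4 :: nat
  assumes "friend_of_10 n"
    and "q3 = prime_divisor_nth n 3"
    and "q4 = prime_divisor_nth n 4"
  shows "(11 \<le> q3 \<and>
      real q3 < real_of_int \<lceil>427 * real (omega n) / 100\<rceil> *
        (ln (real_of_int \<lceil>427 * real (omega n) / 100\<rceil>)
          + 2 * ln (ln (real_of_int \<lceil>427 * real (omega n) / 100\<rceil>)))) \<and>
    (13 \<le> q4 \<and>
      real q4 < real_of_int \<lceil>41 * real (omega n) / 5\<rceil> *
        (ln (real_of_int \<lceil>41 * real (omega n) / 5\<rceil>)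
          + 2 * ln (ln (real_of_int \<lceil>41 * real (omega n) / 5\<rceil>))))"
proof -
  obtain a b c d ys where
    xs: "sorted_list_of_set (prime_factors n) = a # b # c # d # ys" and
    ge: "5 \<le> a" "7 \<le> b" "11 \<le> c" "13 \<le> d" and
    sorted: "sorted_wrt (<) (c # d # ys)" and
    bound: "9 / 5 \<le> prod_list (map euler_factor (a # b # c # d # ys))"
    by (rule friend_of_10_prime_divisors[OF assms(1)])
  have q: "q3 = c" "q4 = d"
    using assms(2,3) by (simp_all add: prime_divisor_nth_def xs)
  have "omega n = length (sorted_list_of_set (prime_factors n))"
    by (simp add: omega_def)
  hence w: "real (omega n) = real (length ys) + 4"
    by (simp add: xs)
  have nonneg: "0 \<le> prod_list (map euler_factor zs)" if "\<forall>z\<in>set zs. 2 \<le> z" for zs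
    using that by (induction zs) (auto simp: euler_factor_nonneg)
  have ge2: "\<forall>z\<in>set (c # d # ys). 2 \<le> z"
    using sorted ge by auto
  have a_le: "euler_factor a \<le> 5 / 4" and b_le: "euler_factor b \<le> 7 / 6"
    and c_le: "euler_factor c \<le> 11 / 10"
    using euler_factor_antimono[OF _ ge(1)] euler_factor_antimono[OF _ ge(2)]
      euler_factor_antimono[OF _ ge(3)] by (simp_all add: euler_factor_def)
  have ab: "euler_factor a * euler_factor b \<le> 35 / 24"
    using mult_mono[OF a_le b_le] euler_factor_nonneg[of b] ge by simp
  have abc: "euler_factor a * euler_factor b * euler_factor c \<le> 77 / 48"
    using mult_mono[OF ab c_le] euler_factor_nonneg[of c] ge by simp

  have "9 / 5 \<le> euler_factor a * euler_factor b * prod_list (map euler_factor (c # d # ys))"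
    using bound by (simp add: mult.assoc)
  also have "\<dots> \<le> 35 / 24 * ((real c + real (length (d # ys))) / (real c - 1))"
    using ab prod_euler_factor_telescope[OF sorted] ge nonneg[OF ge2] by (intro mult_mono) auto
  finally have "real c < 427 * real (omega n) / 100"
    using ge unfolding w by (simp add: field_simps)
  hence third: "real q3 < real_of_int \<lceil>427 * real (omega n) / 100\<rceil> *
        (ln (real_of_int \<lceil>427 * real (omega n) / 100\<rceil>)
          + 2 * ln (ln (real_of_int \<lceil>427 * real (omega n) / 100\<rceil>)))"
    unfolding q using w by (intro less_ceiling_times_log_factor) auto

  have "9 / 5 \<le> euler_factor a * euler_factor b * euler_factor c
      * prod_list (map euler_factor (d # ys))"
    using bound by (simp add: mult.assoc)
  also have "\<dots> \<le> 77 / 48 * ((real d + real (length ys)) / (real d - 1))"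
    using abc prod_euler_factor_telescope[of d ys] sorted ge nonneg[of "d # ys"] ge2
    by (intro mult_mono) auto
  finally have "real d < 41 * real (omega n) / 5"
    using ge unfolding w by (simp add: field_simps)
  hence fourth: "real q4 < real_of_int \<lceil>41 * real (omega n) / 5\<rceil> *
        (ln (real_of_int \<lceil>41 * real (omega n) / 5\<rceil>)
          + 2 * ln (ln (real_of_int \<lceil>41 * real (omega n) / 5\<rceil>)))"
    unfolding q using w by (intro less_ceiling_times_log_factor) auto
  show ?thesis using third fourth ge q by blast
qed

end
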